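(* For every integer $m\ge 2$ and every real $\mu>0$ there exist $\epsilon>0$ and a sequence of $n$-vertex graphs $G_\epsilon=G_\epsilon(n)$ with $\delta(G_\epsilon)\ge(\tfrac12+\epsilon)n$ such that for every $p=p(n)\le n^{-1/f_m(\ell_m)-\mu}$ $$\lim_{n\to\infty}\Pr\big(G_\epsilon\cup G(n,p)\in\mathcal{C}^m_n\big)=0.$$
   Context: For integers $m\ge1$ and $n\ge m+2$, $\mathcal{C}^m_n$ is the family of all $n$-vertex graphs containing the $m$-th power of a Hamiltonian cycle; the $m$-th power $F^m$ of a graph $F$ is the graph on $V(F)$ whose edges join distinct vertices at distance at most $m$ in $F$. $G(n,p)$ is the binomial random graph on the same vertex set as $G_\epsilon$ (each pair is an edge independently with probability $p$), and $G_\epsilon\cup G(n,p)$ is the union of the edge sets. For integers $m\ge2$ and real $\ell\in(0,m]$, $f_m(\ell)=\frac1{\ell}\left(\binom{\ell}{2}+\binom{m-\ell+1}{2}\right)=\ell+\frac{m^2+m}{2\ell}-m-1$. Let $\lambda_m=\frac{\sqrt{2m^2+2m}}{2}$, and let $\ell_m\in\{\lfloor\lambda_m\rfloor,\lceil\lambda_m\rceil\}$ be such that $f_m(\ell_m)=\min\{f_m(\lfloor\lambda_m\rfloor),f_m(\lceil\lambda_m\rceil)\}$, with the convention that if $\lfloor\lambda_m\rfloor\ne\lceil\lambda_m\rceil$ and $f_m(\lfloor\lambda_m\rfloor)=f_m(\lceil\lambda_m\rceil)$, then $\ell_m=\lfloor\lambda_m\rfloor$. *)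

theory Defs
  imports Complex_Main
begin

definition all_pairs :: "nat \<Rightarrow> nat set set" where
  "all_pairs n = {e. \<exists>u v. u < n \<and> v < n \<and> u \<noteq> v \<and> e = {u, v}}"

definition is_graph :: "nat \<Rightarrow> nat set set \<Rightarrow> bool" where
  "is_graph n E \<longleftrightarrow> E \<subseteq> all_pairs n"

definition degree :: "nat set set \<Rightarrow> nat \<Rightarrow> nat" where
  "degree E v = card {u. {u, v} \<in> E}"

definition min_degree :: "nat \<Rightarrow> nat set set \<Rightarrow> nat" where
  "min_degree n E = Min ((degree E) ` {0..<n})"

definition contains_ham_power :: "nat \<Rightarrow> nat \<Rightarrow> nat set set \<Rightarrow> bool" where
  "contains_ham_power m n E \<longleftrightarrow>
     (\<exists>\<sigma>. bij_betw \<sigma> {0..<n} {0..<n} \<and>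
        (\<forall>i<n. \<forall>j\<in>{1..m}. {\<sigma> i, \<sigma> ((i + j) mod n)} \<in> E))"

text \<open>Probability that G \<union> G(n,p) contains the m-th power of a Hamiltonian cycle:
  each pair of [n] is an edge of G(n,p) independently with probability p.\<close>
definition prob_union_ham_power :: "nat \<Rightarrow> nat \<Rightarrow> nat set set \<Rightarrow> real \<Rightarrow> real" where
  "prob_union_ham_power m n G p =
     (\<Sum>S\<in>{S. S \<subseteq> all_pairs n \<and> contains_ham_power m n (G \<union> S)}.
        p ^ card S * (1 - p) ^ (card (all_pairs n) - card S))"

definition f_fun :: "nat \<Rightarrow> real \<Rightarrow> real" where
  "f_fun m l = (1 / l) * (l * (l - 1) / 2 + (real m - l + 1) * (real m - l) / 2)"

definition lambda_m :: "nat \<Rightarrow> real" where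
  "lambda_m m = sqrt (2 * (real m)^2 + 2 * real m) / 2"

definition ell_m :: "nat \<Rightarrow> real" where
  "ell_m m = (let a = real_of_int \<lfloor>lambda_m m\<rfloor>; b = real_of_int \<lceil>lambda_m m\<rceil>
              in if f_fun m b < f_fun m a then b else a)"

end

(*
  The graph G is complete between the even and the odd vertices, plus a small set Z of vertices that
  are joined to everything. Since Z is small, any m-th power of a Hamiltonian cycle has L consecutive
  vertices outside Z, and all pairs of equal parity at distance at most m among them must be random
  edges. A union bound over the at most n^L choices of these vertices succeeds for large L as soon as
  every 2-colouring of a path on N vertices has at least f_m(l_m) N - O(1) monochromatic pairs at
  distance at most m.

  For this, let P(t) be the number of vertices of the first colour in the window [t, t+m). Up to
  telescoping terms, vertex t is the left end of (m-1)/2 monochromatic pairs if t and t+m have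
  different colours, and of g(t) otherwise, where g(t) depends only on P(t); so only such "flat" t
  can be cheap. Split time into phases with P(t) >= m/2 and phases with P(t) <= m/2. In a phase of
  length at most m in which P rises to M, at most m-M flat vertices are cheap, each of them is the
  left end of at least m-M pairs, and at least 2M-m further steps are needed to rise and to fall; the
  phase is then paid for exactly because f_m(l_m) <= f_m(M). Longer phases have slack, as seen by
  cutting them into pieces of length m.
*)
theory Submission
  imports Defs
begin

section \<open>Window counts of a 2-colouring and the cost of flat steps\<close>

definition win :: "nat \<Rightarrow> (nat \<Rightarrow> bool) \<Rightarrow> nat \<Rightarrow> int" where
  "win m x t = (\<Sum>i\<in>{t..<t+m}. of_bool (x i))"

text \<open>The excess over \<open>(m - 1) / 2\<close> of the number of monochromatic pairs with left end \<open>t\<close>,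
  after removal of the telescoping part \<open>w (win t) - w (win (t + 1))\<close>, \<open>w p = p (p - m) / 2\<close>.\<close>
definition flat_cost :: "nat \<Rightarrow> (nat \<Rightarrow> bool) \<Rightarrow> nat \<Rightarrow> real" where
  "flat_cost m x t =
     (if x t \<noteq> x (t + m) then 0
      else if x t then win m x t - (real m - 1) / 2 else (real m + 1) / 2 - win m x t)"

lemma win_Suc: "win m x (Suc t) = win m x t - of_bool (x t) + of_bool (x (t + m))"
proof -
  have "(\<Sum>i\<in>{t..<t+m}. of_bool (x i)) + of_bool (x (t+m)) = (\<Sum>i\<in>{t..<Suc (t+m)}. of_bool (x i) :: int)"
    by simp
  also have "\<dots> = of_bool (x t) + (\<Sum>i\<in>{Suc t..<Suc (t+m)}. of_bool (x i))"
    by (subst sum.atLeast_Suc_lessThan) auto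
  finally show ?thesis by (simp add: win_def)
qed

lemma win_not: "win m (\<lambda>i. \<not> x i) t = int m - win m x t"
proof -
  have "win m (\<lambda>i. \<not> x i) t + win m x t = (\<Sum>i\<in>{t..<t+m}. 1)"
    unfolding win_def sum.distrib[symmetric] by (rule sum.cong) auto
  then show ?thesis by simp
qed

lemma win_nonneg: "0 \<le> win m x t"
  by (simp add: win_def sum_nonneg)

lemma win_le: "win m x t \<le> int m"
  using win_nonneg[of m "\<lambda>i. \<not> x i" t] by (simp add: win_not)

text \<open>Exchanging the colours turns phases with low window counts into phases with high ones,
  so only the latter have to be analysed.\<close>

lemma flat_cost_not: "flat_cost m (\<lambda>i. \<not> x i) t = flat_cost m x t"
  by (auto simp: flat_cost_def win_not field_simps)

section \<open>Steps that raise, lower or keep the window count\<close>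

lemma win_diff:
  assumes "a \<le> b"
  shows "win m x b - win m x a =
    (\<Sum>t\<in>{a..<b}. of_bool (\<not> x t \<and> x (t+m))) - (\<Sum>t\<in>{a..<b}. of_bool (x t \<and> \<not> x (t+m)))"
  using assms
proof (induction b rule: dec_induct)
  case (step n)
  then show ?case by (auto simp: win_Suc)
qed simp

text \<open>The steps of a piece are of four kinds: \<open>U\<close> raise and \<open>D\<close> lower the window count, \<open>A\<close> and
  \<open>R\<close> keep it while passing a vertex of the first, respectively second, colour. Only the \<open>R\<close>
  steps can be cheap; \<open>M\<close> is the largest window count.\<close>
lemma piece_counts:
  assumes ab: "a < b" "b \<le> a + m"
    and high: "\<And>t. a < t \<Longrightarrow> t \<le> b \<Longrightarrow> int m \<le> 2 * win m x t"
  obtains M U R A D :: int where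
    "0 \<le> U" "0 \<le> R" "0 \<le> A" "0 \<le> D"
    "U + R \<le> int m - win m x a" "b = a + m \<Longrightarrow> U + R = int m - win m x a"
    "M \<le> win m x a + U" "win m x a \<le> M" "win m x b \<le> M" "M \<le> int m"
    "win m x b - win m x a = U - D" "U + R + A + D = int (b - a)"
    "real_of_int A / 2 - real_of_int R * (M - (real m + 1) / 2) \<le> (\<Sum>t\<in>{a..<b}. flat_cost m x t)"
proof -
  define U :: int where "U = (\<Sum>t\<in>{a..<b}. of_bool (\<not> x t \<and> x (t+m)))"
  define D :: int where "D = (\<Sum>t\<in>{a..<b}. of_bool (x t \<and> \<not> x (t+m)))"
  define R :: int where "R = (\<Sum>t\<in>{a..<b}. of_bool (\<not> x t \<and> \<not> x (t+m)))"
  define A :: int where "A = (\<Sum>t\<in>{a..<b}. of_bool (x t \<and> x (t+m)))"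
  define M where "M = Max (win m x ` {a..b})"
  have M: "win m x t \<le> M" if "a \<le> t" "t \<le> b" for t
    using that unfolding M_def by (intro Max_ge) auto
  have "M \<in> win m x ` {a..b}"
    unfolding M_def using ab by (intro Max_in) auto
  then obtain c where c: "a \<le> c" "c \<le> b" "M = win m x c" by auto
  \<comment> \<open>Steps of kinds \<open>U\<close> and \<open>R\<close> are exactly those that pass
    a vertex of the second colour, and all these vertices lie in the window at
    \<open>a\<close>.\<close>
  have UR: "U + R = (\<Sum>t\<in>{a..<b}. of_bool (\<not> x t))"
    unfolding U_def R_def sum.distrib[symmetric] by (rule sum.cong) auto
  have wa: "int m - win m x a = (\<Sum>t\<in>{a..<a+m}. of_bool (\<not> x t))"
    using win_not[of m x a] by (simp add: win_def)
  \<comment> \<open>Up to the time \<open>c\<close> of the maximum, each unit of climb needs its own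
    step of kind \<open>U\<close>.\<close>
  have "M - win m x a \<le> (\<Sum>t\<in>{a..<c}. of_bool (\<not> x t \<and> x (t+m)))"
    unfolding c(3) win_diff[OF c(1)] by (simp add: sum_nonneg)
  also have "\<dots> \<le> U"
    unfolding U_def using c by (intro sum_mono2) auto
  finally have MU: "M \<le> win m x a + U" by simp
  have "real_of_int A / 2 - real_of_int R * (M - (real m + 1) / 2) =
    (\<Sum>t\<in>{a..<b}. of_bool (x t \<and> x (t+m)) / 2 - of_bool (\<not> x t \<and> \<not> x (t+m)) * (M - (real m + 1) / 2))"
    unfolding A_def R_def sum_subtractf by (simp add: sum_divide_distrib sum_distrib_right)
  also have "\<dots> \<le> (\<Sum>t\<in>{a..<b}. flat_cost m x t)"
  proof (rule sum_mono)
    fix t assume t: "t \<in> {a..<b}"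
    \<comment> \<open>\<open>high\<close> excludes \<open>a\<close>, where the count may lie just
      below m/2, hence \<open>Suc t\<close>. An \<open>A\<close> step leaves the count unchanged, so
      it costs at least m/2 - (m - 1)/2 = 1/2.\<close>
    have "int m \<le> 2 * win m x (Suc t)" using t by (intro high) auto
    then have "real m \<le> 2 * real_of_int (win m x (Suc t))" by linarith
    moreover have "win m x t \<le> M" using t by (intro M) auto
    ultimately show "of_bool (x t \<and> x (t+m)) / 2 - of_bool (\<not> x t \<and> \<not> x (t+m)) * (M - (real m + 1) / 2)
        \<le> flat_cost m x t"
      by (auto simp: flat_cost_def win_Suc field_simps)
  qed
  finally have fl: "real_of_int A / 2 - real_of_int R * (M - (real m + 1) / 2)
      \<le> (\<Sum>t\<in>{a..<b}. flat_cost m x t)" .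
  show ?thesis
  proof (rule that)
    show "0 \<le> U" "0 \<le> R" "0 \<le> A" "0 \<le> D"
      by (simp_all add: U_def R_def A_def D_def sum_nonneg)
    show "U + R \<le> int m - win m x a"
      unfolding UR wa using ab by (intro sum_mono2) auto
    show "b = a + m \<Longrightarrow> U + R = int m - win m x a"
      unfolding UR wa by simp
    show "M \<le> win m x a + U" by (fact MU)
    show "win m x a \<le> M" "win m x b \<le> M" using M ab by auto
    show "M \<le> int m" using c(3) win_le by simp
    show "win m x b - win m x a = U - D"
      unfolding U_def D_def using ab by (intro win_diff) simp
    have "U + R + A + D = (\<Sum>t\<in>{a..<b}. 1)"
      unfolding U_def D_def A_def R_def sum.distrib[symmetric] by (rule sum.cong) auto
    then show "U + R + A + D = int (b - a)" by simp
  qed (fact fl)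
qed

text \<open>In the application \<open>g = (m - 1) / 2 - f\<^sub>m(\<ell>\<^sub>m)\<close>, and \<open>k\<close> is both what every full piece of \<open>m\<close>
  steps yields and the most that the last, shorter piece of a long phase can lose.\<close>
locale phase_bounds =
  fixes m :: nat and g k :: real
  assumes m_pos: "0 < m" and g_nonneg: "0 \<le> g" and k_nonneg: "0 \<le> k"
    and full: "\<And>R M :: int. 0 \<le> R \<Longrightarrow> R \<le> int m - M \<Longrightarrow> int m \<le> 2 * M \<Longrightarrow>
      k \<le> g * m - R * (M - (real m + 2) / 2)"
    and tail: "\<And>R M :: int. 0 \<le> R \<Longrightarrow> R \<le> int m - M \<Longrightarrow> int m \<le> 2 * M \<Longrightarrow>
      - k \<le> g * (R + M - (real m - real (m div 2))) - R * (M - (real m + 1) / 2)"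
    and short: "\<And>R M :: int. 0 \<le> R \<Longrightarrow> R \<le> int m - M \<Longrightarrow> int m \<le> 2 * M \<Longrightarrow>
      0 \<le> g * (R + 2 * M - m) - R * (M - (real m + 1) / 2)"
begin

section \<open>Energy of a phase, bounded piece by piece\<close>

text \<open>For the intended \<open>g\<close> this is, up to telescoping terms, the excess over
  f_m(l_m) (b - a) of the number of monochromatic pairs with left end in [a, b).\<close>

definition energy :: "(nat \<Rightarrow> bool) \<Rightarrow> nat \<Rightarrow> nat \<Rightarrow> real" where
  "energy x a b = (\<Sum>t\<in>{a..<b}. g + flat_cost m x t)"

lemma energy_eq: "a \<le> b \<Longrightarrow> energy x a b = g * (b - a) + (\<Sum>t\<in>{a..<b}. flat_cost m x t)"
  by (simp add: energy_def sum.distrib of_nat_diff)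

lemma energy_split: "a \<le> b \<Longrightarrow> b \<le> c \<Longrightarrow> energy x a c = energy x a b + energy x b c"
  by (simp add: energy_def sum.atLeastLessThan_concat)

lemma energy_not: "energy (\<lambda>i. \<not> x i) a b = energy x a b"
  by (simp add: energy_def flat_cost_not)

text \<open>In exactly \<open>m\<close> steps A = win(a + m) - U and R = m - win(a) - U, so
  \<open>ends\<close> forces R <= A. The gain A/2 >= R/2 turns the (m + 1)/2 of
  \<open>piece_counts\<close> into the (m + 2)/2 of \<open>full\<close>.\<close>

lemma energy_full:
  assumes high: "\<And>t. a < t \<Longrightarrow> t \<le> a + m \<Longrightarrow> int m \<le> 2 * win m x t"
    and ends: "int m \<le> win m x a + win m x (a + m)"
  shows "k \<le> energy x a (a + m)"
proof -
  obtain M U R A D :: int where c: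
    "0 \<le> U" "0 \<le> R" "0 \<le> A" "0 \<le> D"
    "U + R = int m - win m x a"
    "M \<le> win m x a + U" "win m x (a+m) \<le> M"
    "win m x (a+m) - win m x a = U - D" "U + R + A + D = int (a + m - a)"
    "real_of_int A / 2 - real_of_int R * (M - (real m + 1) / 2) \<le> (\<Sum>t\<in>{a..<a+m}. flat_cost m x t)"
    using piece_counts[of a "a+m" m x] high m_pos by (smt (verit) less_add_same_cancel1 le_refl)
  have "int m \<le> 2 * win m x (a+m)" using high m_pos by simp
  then have M: "int m \<le> 2 * M" using c by linarith
  have "R \<le> int m - M" using c by linarith
  from full[OF c(2) this M] have 1: "k \<le> g * m - R * (M - (real m + 2) / 2)" .
  have "R \<le> A" using c ends by linarith
  then have "real_of_int R / 2 \<le> real_of_int A / 2" by simp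
  moreover have "R * (M - (real m + 2) / 2) = R * (M - (real m + 1) / 2) - real_of_int R / 2"
    by (simp add: field_simps)
  ultimately show ?thesis using 1 c(10) by (simp add: energy_eq)
qed

lemma energy_tail_piece:
  assumes ab: "a < b" "b \<le> a + m"
    and high: "\<And>t. a < t \<Longrightarrow> t \<le> b \<Longrightarrow> int m \<le> 2 * win m x t"
    and "int m \<le> 2 * win m x a" "win m x b = int m - int (m div 2)"
  shows "- k \<le> energy x a b"
proof -
  obtain M U R A D :: int where c:
    "0 \<le> U" "0 \<le> R" "0 \<le> A" "0 \<le> D"
    "U + R \<le> int m - win m x a"
    "M \<le> win m x a + U" "win m x b \<le> M" "win m x a \<le> M"
    "win m x b - win m x a = U - D" "U + R + A + D = int (b - a)"
    "real_of_int A / 2 - real_of_int R * (M - (real m + 1) / 2) \<le> (\<Sum>t\<in>{a..<b}. flat_cost m x t)"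
    using piece_counts[OF ab high] by (smt (verit))
  have M: "int m \<le> 2 * M" using c assms by linarith
  have "R \<le> int m - M" using c by linarith
  from tail[OF c(2) this M]
  have 1: "- k \<le> g * (R + M - (real m - real (m div 2))) - R * (M - (real m + 1) / 2)" .
  \<comment> \<open>The descent from \<open>M\<close> to the final count takes at least M - win(b)
    steps of kind \<open>D\<close>, besides the \<open>R\<close> steps.\<close>
  have "R + M - (int m - int (m div 2)) \<le> int (b - a)" using c assms by linarith
  then have "R + M - (real m - real (m div 2)) \<le> real (b - a)"
    by linarith
  then have "g * (R + M - (real m - real (m div 2))) \<le> g * real (b - a)"
    using g_nonneg by (rule mult_left_mono)
  moreover have "0 \<le> real_of_int A / 2" using c by simp
  ultimately show ?thesis using 1 c(11) ab by (simp add: energy_eq of_nat_diff)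
qed

lemma energy_short:
  assumes ab: "a < b" "b \<le> a + m"
    and high: "\<And>t. a < t \<Longrightarrow> t \<le> b \<Longrightarrow> int m \<le> 2 * win m x t"
    and "win m x a = int (m div 2)" "win m x b = int m - int (m div 2)"
  shows "0 \<le> energy x a b"
proof -
  obtain M U R A D :: int where c:
    "0 \<le> U" "0 \<le> R" "0 \<le> A" "0 \<le> D"
    "U + R \<le> int m - win m x a"
    "M \<le> win m x a + U" "win m x b \<le> M" "win m x a \<le> M"
    "win m x b - win m x a = U - D" "U + R + A + D = int (b - a)"
    "real_of_int A / 2 - real_of_int R * (M - (real m + 1) / 2) \<le> (\<Sum>t\<in>{a..<b}. flat_cost m x t)"
    using piece_counts[OF ab high] by (smt (verit))
  have M: "int m \<le> 2 * M" using c assms by linarith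
  have "R \<le> int m - M" using c by linarith
  from short[OF c(2) this M]
  have 1: "0 \<le> g * (R + 2 * M - m) - R * (M - (real m + 1) / 2)" .
  \<comment> \<open>The climb to \<open>M\<close> and the descent from it together take 2M - m
    steps, because the two end counts add up to \<open>m\<close>.\<close>
  have "R + 2 * M - int m \<le> int (b - a)" using c assms by linarith
  then have "real_of_int (R + 2 * M - int m) \<le> real (b - a)"
    by linarith
  then have "g * real_of_int (R + 2 * M - int m) \<le> g * real (b - a)"
    using g_nonneg by (rule mult_left_mono)
  moreover have "0 \<le> real_of_int A / 2" using c by simp
  ultimately show ?thesis using 1 c(11) ab by (simp add: energy_eq of_nat_diff)
qed

text \<open>Pieces of \<open>m\<close> steps are cut off from the left; each yields at least
  \<open>k\<close>, so only the remainder can lose.\<close>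

lemma energy_tail:
  assumes "a \<le> b" "\<And>t. a \<le> t \<Longrightarrow> t \<le> b \<Longrightarrow> int m \<le> 2 * win m x t"
    and "win m x b = int m - int (m div 2)"
  shows "- k \<le> energy x a b"
  using assms(1,2)
proof (induction "b - a" arbitrary: a rule: less_induct)
  case less
  consider "a = b" | "a < b" "b \<le> a + m" | "a + m < b" using less.prems(1) by linarith
  then show ?case
  proof cases
    case 1
    then show ?thesis using k_nonneg by (simp add: energy_def)
  next
    case 2
    then show ?thesis using less.prems assms(3) by (intro energy_tail_piece) auto
  next
    case 3
    have "- k \<le> energy x (a + m) b"
      using 3 m_pos less.prems by (intro less.hyps) auto
    moreover have "int m \<le> 2 * win m x a" "int m \<le> 2 * win m x (a + m)"
      using 3 less.prems by auto
    then have "int m \<le> win m x a + win m x (a + m)" by linarith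
    then have "k \<le> energy x a (a + m)"
      using 3 less.prems by (intro energy_full) auto
    moreover have "energy x a b = energy x a (a+m) + energy x (a+m) b"
      using 3 by (intro energy_split) auto
    ultimately show ?thesis using k_nonneg by linarith
  qed
qed

text \<open>In a phase longer than \<open>m\<close>, the first full piece earns the \<open>k\<close>
  that the rest may lose.\<close>

lemma energy_phase:
  assumes ab: "a < b"
    and high: "\<And>t. a < t \<Longrightarrow> t \<le> b \<Longrightarrow> int m \<le> 2 * win m x t"
    and ends: "win m x a = int (m div 2)" "win m x b = int m - int (m div 2)"
  shows "0 \<le> energy x a b"
proof (cases "b \<le> a + m")
  case True
  then show ?thesis using assms by (intro energy_short) auto
next
  case False
  have "int m \<le> 2 * win m x (a + m)" using high False m_pos by simp
  then have "int m \<le> win m x a + win m x (a + m)" using ends by linarith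
  then have "k \<le> energy x a (a + m)"
    using high False by (intro energy_full) auto
  moreover have "- k \<le> energy x (a + m) b"
    using high False ends m_pos by (intro energy_tail) auto
  moreover have "energy x a b = energy x a (a+m) + energy x (a+m) b"
    using False by (intro energy_split) auto
  ultimately show ?thesis by linarith
qed

lemma energy_partial_piece:
  assumes ab: "a < b" "b \<le> a + m"
    and high: "\<And>t. a < t \<Longrightarrow> t \<le> b \<Longrightarrow> int m \<le> 2 * win m x t"
  shows "- real (m * m) \<le> energy x a b"
proof -
  obtain M U R A D :: int where c:
    "0 \<le> U" "0 \<le> R" "0 \<le> A" "0 \<le> D"
    "U + R \<le> int m - win m x a" "M \<le> int m"
    "real_of_int A / 2 - real_of_int R * (M - (real m + 1) / 2) \<le> (\<Sum>t\<in>{a..<b}. flat_cost m x t)"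
    using piece_counts[OF ab high] by (smt (verit))
  have "R \<le> int m" using c win_nonneg[of m x a] by linarith
  then have R: "0 \<le> real_of_int R" "real_of_int R \<le> m" using c by linarith+
  have "real_of_int M \<le> m" using c(6) by linarith
  have "real_of_int R * (M - (real m + 1) / 2) \<le> real_of_int R * real m"
    by (rule mult_left_mono[OF _ R(1)]) (use \<open>real_of_int M \<le> m\<close> in \<open>simp add: field_simps\<close>)
  also have "\<dots> \<le> real m * m" using R by (intro mult_right_mono) auto
  finally have "real_of_int R * (M - (real m + 1) / 2) \<le> real m * m" .
  moreover have "0 \<le> g * real (b - a)" "0 \<le> real_of_int A / 2" using g_nonneg c by simp_all
  ultimately show ?thesis using c(7) ab by (simp add: energy_eq of_nat_diff)
qed

text \<open>This handles phases without prescribed end counts. Full pieces do not lose, so the loss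
  comes from the last piece alone.\<close>

lemma energy_partial:
  assumes "a \<le> b" "\<And>t. a < t \<Longrightarrow> t \<le> b \<Longrightarrow> int m \<le> 2 * win m x t"
    "int (m div 2) \<le> win m x a"
  shows "- real (m * m) \<le> energy x a b"
  using assms
proof (induction "b - a" arbitrary: a rule: less_induct)
  case less
  consider "a = b" | "a < b" "b \<le> a + m" | "a + m < b" using less.prems(1) by linarith
  then show ?case
  proof cases
    case 1
    then show ?thesis by (simp add: energy_def)
  next
    case 2
    then show ?thesis using less.prems by (intro energy_partial_piece) auto
  next
    case 3
    have p: "int m \<le> 2 * win m x (a + m)" using less.prems 3 m_pos by auto
    then have "int (m div 2) \<le> win m x (a + m)" by linarith
    then have "- real (m * m) \<le> energy x (a + m) b"
      using 3 m_pos less.prems by (intro less.hyps) auto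
    moreover have "int m \<le> win m x a + win m x (a + m)"
      using p less.prems(3) by linarith
    then have "k \<le> energy x a (a + m)"
      using 3 less.prems by (intro energy_full) auto
    moreover have "energy x a b = energy x a (a+m) + energy x (a+m) b"
      using 3 by (intro energy_split) auto
    ultimately show ?thesis using k_nonneg by linarith
  qed
qed

text \<open>The count changes by at most one per step, so the first drop below m/2 starts exactly at
  m/2 rounded up. For the exchanged colours this is the start of a new phase.\<close>

lemma win_first_drop:
  assumes "int m \<le> 2 * win m x a" "a < c" "2 * win m x c < int m"
  obtains b where "a \<le> b" "b < c" "win m x b = int m - int (m div 2)"
    "win m x (Suc b) = int m - int (m div 2) - 1"
    "\<And>t. a < t \<Longrightarrow> t \<le> b \<Longrightarrow> int m \<le> 2 * win m x t"
proof -
  define d where "d = (LEAST t. a < t \<and> 2 * win m x t < int m)"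
  have d: "a < d" "2 * win m x d < int m"
    using LeastI[of "\<lambda>t. a < t \<and> 2 * win m x t < int m" c] assms by (auto simp: d_def)
  have dmin: "int m \<le> 2 * win m x t" if "a < t" "t < d" for t
    using not_less_Least[of t "\<lambda>t. a < t \<and> 2 * win m x t < int m"] that by (auto simp: d_def)
  have "d \<le> c" using assms unfolding d_def by (intro Least_le) auto
  define b where "b = d - 1"
  have b: "d = Suc b" "a \<le> b" using d by (auto simp: b_def)
  have "int m \<le> 2 * win m x b"
    using dmin[of b] b d assms(1) by (cases "a = b") auto
  moreover have "win m x (Suc b) \<ge> win m x b - 1" by (simp add: win_Suc)
  moreover have "2 * win m x (Suc b) < int m" using d(2) b(1) by simp
  ultimately have "win m x b = int m - int (m div 2)" "win m x (Suc b) = int m - int (m div 2) - 1"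
    by linarith+
  then show ?thesis
    using b \<open>d \<le> c\<close> dmin by (intro that[of b]) auto
qed

lemma energy_from_crossing:
  assumes "a \<le> n" "win m x a = int (m div 2)" "win m x (Suc a) = int (m div 2) + 1"
  shows "- real (m * m) \<le> energy x a n"
  \<comment> \<open>A phase ends in the state in which the next one starts, with the two colours exchanged.\<close>
  using assms
proof (induction "n - a" arbitrary: a x rule: less_induct)
  case less
  have Suc_high: "int m \<le> 2 * win m x (Suc a)" using less.prems by linarith
  show ?case
  proof (cases "\<forall>t. a < t \<and> t \<le> n \<longrightarrow> int m \<le> 2 * win m x t")
    case True
    then show ?thesis using less.prems by (intro energy_partial) auto
  next
    case False
    then obtain c where c: "a < c" "c \<le> n" "2 * win m x c < int m" by auto
    have "\<exists>b>a. b < c \<and> win m x b = int m - int (m div 2) \<and>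
      win m x (Suc b) = int m - int (m div 2) - 1 \<and>
      (\<forall>t. a < t \<and> t \<le> b \<longrightarrow> int m \<le> 2 * win m x t)"
    proof -
      \<comment> \<open>The search starts at \<open>Suc a\<close>, since for odd \<open>m\<close>
        the count at \<open>a\<close> is below m/2. This also gives b > a, so the induction makes
        progress.\<close>
      have "Suc a < c" using c Suc_high by (cases "c = Suc a") auto
      with c Suc_high obtain b where b: "Suc a \<le> b" "b < c" "win m x b = int m - int (m div 2)"
        "win m x (Suc b) = int m - int (m div 2) - 1"
        "\<And>t. Suc a < t \<Longrightarrow> t \<le> b \<Longrightarrow> int m \<le> 2 * win m x t"
        using win_first_drop[of x "Suc a" c] by metis
      have "int m \<le> 2 * win m x t" if "a < t" "t \<le> b" for t
        using that b(5) Suc_high by (cases "t = Suc a") auto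
      with b show ?thesis by (intro exI[of _ b]) auto
    qed
    then obtain b where b: "a < b" "b < c" "win m x b = int m - int (m div 2)"
        "win m x (Suc b) = int m - int (m div 2) - 1"
        "\<And>t. a < t \<Longrightarrow> t \<le> b \<Longrightarrow> int m \<le> 2 * win m x t" by blast
    have "0 \<le> energy x a b" using b less.prems by (intro energy_phase) auto
    moreover have "- real (m * m) \<le> energy (\<lambda>i. \<not> x i) b n"
      using b c by (intro less.hyps) (auto simp: win_not)
    moreover have "energy x a n = energy x a b + energy x b n"
      using b c by (intro energy_split) auto
    ultimately show ?thesis by (simp add: energy_not)
  qed
qed

text \<open>The initial phase need not begin at a crossing, so it is charged as a partial phase;
  this accounts for the second m^2.\<close>

lemma energy_from_high:
  assumes "int m \<le> 2 * win m x 0"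
  shows "- 2 * real (m * m) \<le> energy x 0 n"
proof (cases "\<forall>t. 0 < t \<and> t \<le> n \<longrightarrow> int m \<le> 2 * win m x t")
  case True
  then have "- real (m * m) \<le> energy x 0 n" using assms by (intro energy_partial) auto
  then show ?thesis using of_nat_0_le_iff[of "m * m", where 'a=real] by linarith
next
  case False
  then obtain c where c: "0 < c" "c \<le> n" "2 * win m x c < int m" by auto
  with assms obtain b where b: "b < c" "win m x b = int m - int (m div 2)"
      "win m x (Suc b) = int m - int (m div 2) - 1"
      "\<And>t. 0 < t \<Longrightarrow> t \<le> b \<Longrightarrow> int m \<le> 2 * win m x t"
    using win_first_drop[of x 0 c] by metis
  have "- real (m * m) \<le> energy x 0 b" using b assms by (intro energy_partial) auto
  moreover have "- real (m * m) \<le> energy (\<lambda>i. \<not> x i) b n"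
    using b c by (intro energy_from_crossing) (auto simp: win_not)
  moreover have "energy x 0 n = energy x 0 b + energy x b n"
    using b c by (intro energy_split) auto
  ultimately show ?thesis by (simp add: energy_not)
qed

lemma energy_lower: "- 2 * real (m * m) \<le> energy x 0 n"
proof (cases "int m \<le> 2 * win m x 0")
  case True
  then show ?thesis by (rule energy_from_high)
next
  case False
  then have "int m \<le> 2 * win m (\<lambda>i. \<not> x i) 0" by (simp add: win_not)
  from energy_from_high[OF this] show ?thesis by (simp add: energy_not)
qed

end

section \<open>Lower bound on the number of monochromatic pairs\<close>

definition same_after :: "nat \<Rightarrow> (nat \<Rightarrow> bool) \<Rightarrow> nat \<Rightarrow> nat" where
  "same_after m x t = card {j\<in>{1..m}. x (t + j) = x t}"

lemma same_after_eq_win: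
  "int (same_after m x t) = (if x t then win m x (Suc t) else int m - win m x (Suc t))"
proof -
  have *: "int (card {j\<in>{1..m}. y (t + j)}) = win m y (Suc t)" for y
  proof -
    have "win m y (Suc t) = (\<Sum>j\<in>{1..m}. of_bool (y (t + j)))"
      unfolding win_def by (rule sum.reindex_bij_witness[of _ "\<lambda>j. t + j" "\<lambda>i. i - t"]) auto
    also have "\<dots> = int (card {j\<in>{1..m}. y (t + j)})"
      by (simp add: of_bool_def sum.If_cases Int_def)
    finally show ?thesis ..
  qed
  show ?thesis
    using *[of x] *[of "\<lambda>i. \<not> x i"] by (auto simp: same_after_def win_not)
qed

context phase_bounds begin

lemma sum_same_after_lower:
  "((real m - 1) / 2 - g) * n - 3 * real (m * m) \<le> (\<Sum>t<n. real (same_after m x t))"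
proof -
  define w where "w p = real_of_int p * (p - real m) / 2" for p :: int
  \<comment> \<open>The quadratic potential \<open>w\<close> is chosen so that every step that
    changes the count contributes exactly (m - 1)/2 after telescoping.\<close>
  have step: "real (same_after m x t) =
      ((real m - 1) / 2 - g) + (w (win m x t) - w (win m x (Suc t))) + (g + flat_cost m x t)" for t
  proof -
    have "real (same_after m x t) = real_of_int (int (same_after m x t))" by simp
    also have "\<dots> = ((real m - 1) / 2 - g) + (w (win m x t) - w (win m x (Suc t))) + (g + flat_cost m x t)"
      unfolding same_after_eq_win w_def flat_cost_def
      by (auto simp: win_Suc field_simps)
    finally show ?thesis .
  qed
  have "(\<Sum>t<n. real (same_after m x t)) =
    ((real m - 1) / 2 - g) * n + (w (win m x 0) - w (win m x n)) + energy x 0 n"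
    unfolding step sum.distrib sum_lessThan_telescope'[of "\<lambda>t. w (win m x t)"] energy_def
    by (simp add: lessThan_atLeast0 sum.distrib)
  moreover have "- real (m * m) \<le> w (win m x 0)" 
  proof -
    have "0 \<le> real_of_int (win m x 0)" "real_of_int (win m x 0) \<le> m"
      using win_nonneg[of m x 0] win_le[of m x 0] by auto
    then have "real_of_int (win m x 0) * (real m - win m x 0) \<le> real m * m"
      by (intro mult_mono) auto
    moreover have "w (win m x 0) = - (real_of_int (win m x 0) * (real m - win m x 0)) / 2"
      by (simp add: w_def field_simps)
    moreover have "0 \<le> real m * real m" by simp
    ultimately show ?thesis unfolding of_nat_mult by linarith
  qed
  moreover have "w (win m x n) \<le> 0"
    using win_nonneg[of m x n] win_le[of m x n] by (auto simp: w_def mult_nonneg_nonpos)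
  moreover have "- 2 * real (m * m) \<le> energy x 0 n" by (rule energy_lower)
  ultimately show ?thesis by linarith
qed

end

section \<open>Minimising f_m over the integers\<close>

lemma f_fun_eq: "0 < l \<Longrightarrow> f_fun m l = l + real m * (real m + 1) / (2 * l) - real m - 1"
  by (simp add: f_fun_def field_simps)

text \<open>The sign is that of (y - x)(xy - lambda^2) with lambda = \<open>lambda_m m\<close>,
  which gives monotonicity on either side of lambda without derivatives.\<close>

lemma f_fun_diff:
  assumes "0 < x" "0 < y"
  shows "f_fun m y - f_fun m x = (y - x) * (x * y - real m * (real m + 1) / 2) / (x * y)"
  using assms by (simp add: f_fun_eq divide_simps) (simp add: algebra_simps)

lemma lambda_m_square: "(lambda_m m)\<^sup>2 = real m * (real m + 1) / 2"
  by (simp add: lambda_m_def power_divide) (simp add: power2_eq_square algebra_simps)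

lemma lambda_m_ge_1: "1 \<le> m \<Longrightarrow> 1 \<le> lambda_m m"
  by (rule power2_le_imp_le)
    (use mult_mono[of 1 "real m" 2 "real m + 1"] in \<open>simp_all add: lambda_m_square, simp add: lambda_m_def\<close>)

lemma ell_m_cases: "ell_m m = real_of_int \<lfloor>lambda_m m\<rfloor> \<or> ell_m m = real_of_int \<lceil>lambda_m m\<rceil>"
  by (simp add: ell_m_def Let_def)

lemma f_ell_le:
  "f_fun m (ell_m m) \<le> f_fun m (real_of_int \<lfloor>lambda_m m\<rfloor>)"
  "f_fun m (ell_m m) \<le> f_fun m (real_of_int \<lceil>lambda_m m\<rceil>)"
  by (simp_all add: ell_m_def Let_def)

lemma f_ell_min:
  assumes m: "1 \<le> m" and a: "1 \<le> (a :: int)"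
  shows "f_fun m (ell_m m) \<le> f_fun m a"
proof (cases "a \<le> \<lfloor>lambda_m m\<rfloor>")
  case True
  define p where "p = real_of_int \<lfloor>lambda_m m\<rfloor>"
  have p: "real_of_int a \<le> p" "p \<le> lambda_m m" "0 < p"
    using True a unfolding p_def by linarith+
  have "a * p \<le> lambda_m m * lambda_m m"
    using p a by (intro mult_mono) auto
  then have "(p - a) * (a * p - real m * (real m + 1) / 2) / (a * p) \<le> 0"
    using p a by (intro divide_nonpos_pos mult_nonneg_nonpos)
      (auto simp: lambda_m_square[symmetric] power2_eq_square)
  then have "f_fun m p \<le> f_fun m a"
    using f_fun_diff[of "real_of_int a" p m] p a by simp
  then show ?thesis using f_ell_le(1)[of m] by (simp add: p_def)
next
  case False
  define q where "q = real_of_int \<lceil>lambda_m m\<rceil>"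
  have "\<lceil>lambda_m m\<rceil> \<le> a" using False by (simp add: ceiling_le_iff) linarith
  then have q: "q \<le> real_of_int a" "lambda_m m \<le> q" by (auto simp: q_def)
  have "1 \<le> lambda_m m" using m by (rule lambda_m_ge_1)
  then have "lambda_m m * lambda_m m \<le> q * a"
    using q by (intro mult_mono) auto
  then have "0 \<le> (a - q) * (q * a - real m * (real m + 1) / 2) / (q * a)"
    using q \<open>1 \<le> lambda_m m\<close> by (intro divide_nonneg_pos mult_nonneg_nonneg)
      (auto simp: lambda_m_square[symmetric] power2_eq_square)
  then have "f_fun m q \<le> f_fun m a"
    using f_fun_diff[of q "real_of_int a" m] q \<open>1 \<le> lambda_m m\<close> a by simp
  then show ?thesis using f_ell_le(2)[of m] by (simp add: q_def)
qed

text \<open>Minimality of f_m(l_m) in polynomial form, with the test integer \<open>a\<close> still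
  free.\<close>

lemma f_ell_mult_le:
  assumes "1 \<le> m" "1 \<le> (a :: int)"
  shows "f_fun m (ell_m m) * a \<le> (real_of_int a)\<^sup>2 - a - real m * a + real m * (real m + 1) / 2"
proof -
  have "f_fun m (ell_m m) * a \<le> f_fun m a * a"
    using assms f_ell_min[OF assms] by (intro mult_right_mono) auto
  also have "\<dots> = (real_of_int a)\<^sup>2 - a - real m * a + real m * (real m + 1) / 2"
    using assms by (simp add: f_fun_eq field_simps power2_eq_square)
  finally show ?thesis .
qed

lemma f_ell_pos:
  assumes "2 \<le> m"
  shows "0 < f_fun m (ell_m m)"
proof -
  obtain a :: int where a: "ell_m m = a" "1 \<le> a"
    using ell_m_cases[of m] lambda_m_ge_1[of m] assms by (auto simp: le_floor_iff le_ceiling_iff)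
  \<comment> \<open>This is a f_m(a) after completing the square.\<close>
  have "0 < (real_of_int a - (real m + 1) / 2)\<^sup>2 + ((real m)\<^sup>2 - 1) / 4"
    using assms power_mono[of 2 "real m" 2] by (intro add_nonneg_pos) auto
  also have "\<dots> = f_fun m a * a"
    using a by (simp add: f_fun_eq field_simps power2_eq_square)
  finally show ?thesis using a by (simp add: zero_less_mult_iff)
qed

text \<open>The left side is (m - 2)^2/16 + (m - 1)^2/16: the largest losses that
  \<open>mult_le_quarter_square\<close> allows in a full piece and in a tail piece.\<close>

lemma f_ell_upper:
  assumes "4 \<le> m"
  shows "(2 * real m ^ 2 - 6 * real m + 5) / 16
    \<le> ((real m - 1) / 2 - f_fun m (ell_m m)) * (real m + real (m div 2))"
proof (cases "m \<le> 16")
  case True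
  \<comment> \<open>Each case uses the integer that minimises \<open>f_fun m\<close>.\<close>
  note le = f_ell_mult_le[of m]
  from True assms have "m = 4 \<or> m = 5 \<or> m = 6 \<or> m = 7 \<or> m = 8 \<or> m = 9 \<or> m = 10 \<or> m = 11 \<or> m = 12 \<or> m = 13 \<or> m = 14 \<or> m = 15 \<or> m = 16"
    by presburger
  then consider "m = 4" | "m = 5" | "m = 6" | "m = 7" | "m = 8" | "m = 9" | "m = 10" | "m = 11" | "m = 12" | "m = 13" | "m = 14" | "m = 15" | "m = 16"
    by blast
  then show ?thesis
  proof cases
    case 1 then show ?thesis using le[of 3] by (simp add: power2_eq_square)
  next
    case 2 then show ?thesis using le[of 4] by (simp add: power2_eq_square)
  next
    case 3 then show ?thesis using le[of 5] by (simp add: power2_eq_square)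
  next
    case 4 then show ?thesis using le[of 5] by (simp add: power2_eq_square)
  next
    case 5 then show ?thesis using le[of 6] by (simp add: power2_eq_square)
  next
    case 6 then show ?thesis using le[of 7] by (simp add: power2_eq_square)
  next
    case 7 then show ?thesis using le[of 7] by (simp add: power2_eq_square)
  next
    case 8 then show ?thesis using le[of 8] by (simp add: power2_eq_square)
  next
    case 9 then show ?thesis using le[of 9] by (simp add: power2_eq_square)
  next
    case 10 then show ?thesis using le[of 10] by (simp add: power2_eq_square)
  next
    case 11 then show ?thesis using le[of 10] by (simp add: power2_eq_square)
  next
    case 12 then show ?thesis using le[of 11] by (simp add: power2_eq_square)
  next
    case 13 then show ?thesis using le[of 12] by (simp add: power2_eq_square)
  qed
next
  case False
  define f where "f = f_fun m (ell_m m)"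
  \<comment> \<open>Any integer in \<open>[2 (m + 1) / 3, 3 m / 4]\<close> gives \<open>f \<le> (5 m - 4) / 12\<close>, which suffices.\<close>
  define a where "a = int (3 * m div 4)"
  \<comment> \<open>Since a >= (3m - 3)/4, the second inequality follows once m >= 17; this fixes
    the range of the explicit cases.\<close>
  have "4 * a \<le> 3 * int m" "2 * int m + 2 \<le> 3 * a" using False by (auto simp: a_def)
  then have a: "4 * real_of_int a \<le> 3 * real m" "2 * real m + 2 \<le> 3 * real_of_int a" "1 \<le> a"
    by linarith+
  \<comment> \<open>The product equals 12 times the bound of \<open>f_ell_mult_le\<close> minus (5m
    - 4) a.\<close>
  have "(4 * real_of_int a - 3 * real m) * (3 * real_of_int a - (2 * real m + 2)) \<le> 0"
    using a by (intro mult_nonpos_nonneg) auto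
  then have "f * a \<le> (5 * real m - 4) / 12 * a"
    using f_ell_mult_le[of m a] a False by (simp add: f_def field_simps power2_eq_square)
  then have f: "f \<le> (5 * real m - 4) / 12" using a by simp
  have "(2 * real m ^ 2 - 6 * real m + 5) / 16 \<le> (real m - 2) / 12 * ((3 * real m - 1) / 2)"
    using False by (simp add: field_simps power2_eq_square)
  also have "\<dots> \<le> ((real m - 1) / 2 - f) * (real m + real (m div 2))"
    using f False by (intro mult_mono) (auto simp: field_simps)
  finally show ?thesis by (simp add: f_def)
qed

section \<open>Verification of the phase inequalities for f_m(l_m)\<close>

lemma mult_le_quarter_square:
  fixes R M c n :: real
  assumes "0 \<le> R" "R \<le> n - M"
  shows "R * (M - c) \<le> (n - c)\<^sup>2 / 4"
proof -
  have "R * (M - c) \<le> R * (n - R - c)" using assms by (intro mult_left_mono) auto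
  also have "\<dots> = (n - c)\<^sup>2 / 4 - (R - (n - c) / 2)\<^sup>2"
    by (simp add: power2_eq_square field_simps)
  also have "\<dots> \<le> (n - c)\<^sup>2 / 4" by simp
  finally show ?thesis .
qed

lemma f_ell_le_half:
  assumes "1 \<le> m"
  shows "f_fun m (ell_m m) \<le> (real m - 1) / 2"
proof -
  have "f_fun m (real m) = (real m - 1) / 2"
    using assms by (simp add: f_fun_def)
  then show ?thesis using f_ell_min[of m "int m"] assms by simp
qed

lemma phase_bounds_f_ell:
  assumes m: "2 \<le> m"
  obtains k where "phase_bounds m ((real m - 1) / 2 - f_fun m (ell_m m)) k"
proof -
  define g where "g = (real m - 1) / 2 - f_fun m (ell_m m)"
  have g: "0 \<le> g" using f_ell_le_half[of m] m by (simp add: g_def)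
  have short: "0 \<le> g * (R + 2 * M - m) - R * (M - (real m + 1) / 2)"
    if R: "0 \<le> R" "R \<le> int m - M" "int m \<le> 2 * M" for R M :: int
  \<comment> \<open>The bound is linear in \<open>R\<close> with slope g - (M - (m + 1)/2). For
    nonnegative slope R = 0 is the worst case; otherwise it is R = m - M, where the claim is
    \<open>f_ell_mult_le\<close> at a = M.\<close>
  proof (cases "M - (real m + 1) / 2 \<le> g")
    case True
    have "0 \<le> g * (2 * M - real m)" using g R by (intro mult_nonneg_nonneg) linarith+
    moreover have "R * (M - (real m + 1) / 2) \<le> R * g" using True R by (intro mult_left_mono) auto
    ultimately show ?thesis by (simp add: algebra_simps)
  next
    case False
    have "real_of_int R * (M - (real m + 1) / 2 - g) \<le> (real m - M) * (M - (real m + 1) / 2 - g)"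
      using False R by (intro mult_right_mono) linarith+
    moreover have "f_fun m (ell_m m) * M \<le> (real_of_int M)\<^sup>2 - M - real m * M + real m * (real m + 1) / 2"
      using R m by (intro f_ell_mult_le) auto
    ultimately show ?thesis by (simp add: g_def field_simps power2_eq_square)
  qed
  show ?thesis
  proof (cases "m \<le> 3")
    case True
    \<comment> \<open>If \<open>R\<close> is nonzero, then M <= m - 1, and m <= 3 makes M - (m +
      1)/2 nonpositive. So no piece loses and k = 0 suffices.\<close>
    have *: "R = 0 \<or> M \<le> int m - 1" if "0 \<le> R" "R \<le> int m - M" for R M :: int
      using that by linarith
    have "phase_bounds m g 0"
    proof (unfold_locales, goal_cases)
      case (4 R M)
      have "real_of_int R * (M - (real m + 2) / 2) \<le> 0"
        using *[OF 4(1,2)]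
      proof
        assume "M \<le> int m - 1"
        then show ?thesis using 4(1) True by (intro mult_nonneg_nonpos) auto
      qed simp
      moreover have "0 \<le> g * m" using g by simp
      ultimately show ?case by linarith
    next
      case (5 R M)
      have "real_of_int R * (M - (real m + 1) / 2) \<le> 0"
        using *[OF 5(1,2)]
      proof
        assume "M \<le> int m - 1"
        then show ?thesis using 5(1) True by (intro mult_nonneg_nonpos) auto
      qed simp
      moreover have "int m - int (m div 2) \<le> M" using 5 by linarith
      then have "real m - real (m div 2) \<le> M" by linarith
      then have "0 \<le> g * (R + M - (real m - real (m div 2)))"
        using g 5(1) by (intro mult_nonneg_nonneg) auto
      ultimately show ?case by linarith
    qed (use m g short in auto)
    then show ?thesis by (intro that) (simp add: g_def)
  next
    case False
    \<comment> \<open>This is what the quadratic estimate guarantees for a full piece.\<close>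
    define k where "k = g * m - (real m - 2)\<^sup>2 / 16"
    have up: "(2 * real m ^ 2 - 6 * real m + 5) / 16 \<le> g * m + g * real (m div 2)"
      using f_ell_upper[of m] False by (simp add: g_def distrib_left)
    have half: "g * real (m div 2) \<le> g * (m / 2)" using g by (intro mult_left_mono) auto
    have k: "0 \<le> k"
    proof -
      have "3 * (real m - 2)\<^sup>2 \<le> 2 * (2 * real m ^ 2 - 6 * real m + 5)"
        using mult_mono[of 2 "real m" 2 "real m"] m by (simp add: power2_eq_square algebra_simps)
      with up half show ?thesis by (simp add: k_def)
    qed
    have "phase_bounds m g k"
    proof (unfold_locales, goal_cases)
      case (4 R M)
      have "real_of_int R * (M - (real m + 2) / 2) \<le> (real m - (real m + 2) / 2)\<^sup>2 / 4"
        using 4 by (intro mult_le_quarter_square) linarith+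
      also have "\<dots> = (real m - 2)\<^sup>2 / 16" by (simp add: power2_eq_square field_simps)
      finally show ?case by (simp add: k_def)
    next
      case (5 R M)
      have "int m - int (m div 2) \<le> M" using 5 by linarith
      then have M: "0 \<le> M - (real m - real (m div 2))" by linarith
      show ?case
      proof (cases "M - (real m + 1) / 2 \<le> g")
        case True
        have "0 \<le> g * (M - (real m - real (m div 2)))" using g M by simp
        moreover have "R * (M - (real m + 1) / 2) \<le> R * g" using True 5 by (intro mult_left_mono) auto
        ultimately show ?thesis using k by (simp add: algebra_simps)
      next
        \<comment> \<open>Again R = m - M is the worst case. It requires (m - 1)^2/16 <= k + g (m
          div 2), which is \<open>up\<close>.\<close>
        case False
        have "real_of_int R * (M - (real m + 1) / 2 - g) \<le> (real m - M) * (M - (real m + 1) / 2 - g)"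
          using False 5 by (intro mult_right_mono) linarith+
        moreover have "(real m - M) * (M - (real m + 1) / 2) \<le> (real m - (real m + 1) / 2)\<^sup>2 / 4"
          using 5 by (intro mult_le_quarter_square) linarith+
        ultimately show ?thesis using up
          by (simp add: k_def field_simps power2_eq_square)
      qed
    qed (use m g k short in auto)
    then show ?thesis by (intro that) (simp add: g_def)
  qed
qed

lemma sum_same_after_ge:
  assumes "2 \<le> m"
  shows "f_fun m (ell_m m) * n - 3 * real (m * m) \<le> (\<Sum>t<n. real (same_after m x t))"
proof -
  obtain k where "phase_bounds m ((real m - 1) / 2 - f_fun m (ell_m m)) k"
    using phase_bounds_f_ell[OF assms] .
  then interpret phase_bounds m "(real m - 1) / 2 - f_fun m (ell_m m)" k .
  show ?thesis using sum_same_after_lower[of n x] by simp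
qed

section \<open>Union bound for the binomial random graph\<close>

lemma sum_Pow_card:
  fixes p q :: "'a :: comm_semiring_1"
  assumes "finite X"
  shows "(\<Sum>S\<in>Pow X. p ^ card S * q ^ (card X - card S)) = (p + q) ^ card X"
proof -
  have "(p + q) ^ card X = (\<Prod>x\<in>X. p + q)" by simp
  also have "\<dots> = (\<Sum>S\<in>Pow X. (\<Prod>x\<in>S. p) * (\<Prod>x\<in>X - S. q))"
    using assms by (rule prod_add)
  also have "\<dots> = (\<Sum>S\<in>Pow X. p ^ card S * q ^ (card X - card S))"
    using assms by (intro sum.cong) (auto simp: card_Diff_subset finite_subset)
  finally show ?thesis ..
qed

text \<open>This is the probability that the random set contains \<open>T\<close>; the choices
  outside \<open>T\<close> sum to 1 by the binomial expansion.\<close>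

lemma sum_superset_card:
  fixes p :: real
  assumes X: "finite X" and T: "T \<subseteq> X"
  shows "(\<Sum>S | T \<subseteq> S \<and> S \<subseteq> X. p ^ card S * (1 - p) ^ (card X - card S)) = p ^ card T"
proof -
  have fin: "finite T" using X T by (rule rev_finite_subset)
  have "(\<Sum>S | T \<subseteq> S \<and> S \<subseteq> X. p ^ card S * (1 - p) ^ (card X - card S)) =
    (\<Sum>S\<in>Pow (X - T). p ^ (card T + card S) * (1 - p) ^ (card X - (card T + card S)))"
  proof (rule sum.reindex_bij_witness[of _ "\<lambda>S. T \<union> S" "\<lambda>S. S - T"])
    fix S assume "S \<in> {S. T \<subseteq> S \<and> S \<subseteq> X}"
    then have S: "T \<subseteq> S" "S \<subseteq> X" by auto
    then have "card T + card (S - T) = card S"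
      using fin X by (metis card_mono card_Diff_subset finite_subset le_add_diff_inverse)
    then show "p ^ (card T + card (S - T)) * (1 - p) ^ (card X - (card T + card (S - T))) =
      p ^ card S * (1 - p) ^ (card X - card S)" by simp
  qed (use T in auto)
  also have "\<dots> = p ^ card T * (\<Sum>S\<in>Pow (X - T). p ^ card S * (1 - p) ^ (card (X - T) - card S))"
    using fin T by (simp add: sum_distrib_left power_add card_Diff_subset mult.assoc)
  also have "\<dots> = p ^ card T"
    using X by (subst sum_Pow_card) auto
  finally show ?thesis .
qed

text \<open>\<open>Q\<close> is the event and \<open>W\<close> a set of witnesses: every outcome in
  \<open>Q\<close> contains some \<open>T w\<close>, so summing over \<open>W\<close> counts it at
  least once.\<close>

lemma union_bound_supersets:
  fixes p :: real
  assumes X: "finite X" and W: "finite W" and p: "0 \<le> p" "p \<le> 1"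
    and T: "\<And>w. w \<in> W \<Longrightarrow> T w \<subseteq> X"
    and cover: "\<And>S. S \<subseteq> X \<Longrightarrow> Q S \<Longrightarrow> \<exists>w\<in>W. T w \<subseteq> S"
  shows "(\<Sum>S | S \<subseteq> X \<and> Q S. p ^ card S * (1 - p) ^ (card X - card S)) \<le> (\<Sum>w\<in>W. p ^ card (T w))"
proof -
  define wt where "wt S = p ^ card S * (1 - p) ^ (card X - card S)" for S :: "'a set"
  have wt: "0 \<le> wt S" for S using p by (simp add: wt_def)
  have "(\<Sum>S | S \<subseteq> X \<and> Q S. wt S) \<le> (\<Sum>S | S \<subseteq> X \<and> Q S. \<Sum>w\<in>W. if T w \<subseteq> S then wt S else 0)"
  proof (rule sum_mono)
    fix S assume "S \<in> {S. S \<subseteq> X \<and> Q S}"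
    then obtain w where w: "w \<in> W" "T w \<subseteq> S" using cover by blast
    have "(if T w \<subseteq> S then wt S else 0) \<le> (\<Sum>w\<in>W. if T w \<subseteq> S then wt S else 0)"
      using w W wt by (intro member_le_sum) auto
    with w show "wt S \<le> (\<Sum>w\<in>W. if T w \<subseteq> S then wt S else 0)" by simp
  qed
  also have "\<dots> = (\<Sum>w\<in>W. \<Sum>S | S \<subseteq> X \<and> Q S. if T w \<subseteq> S then wt S else 0)"
    by (rule sum.swap)
  also have "\<dots> \<le> (\<Sum>w\<in>W. p ^ card (T w))"
  proof (rule sum_mono)
    fix w assume w: "w \<in> W"
    have "(\<Sum>S | S \<subseteq> X \<and> Q S. if T w \<subseteq> S then wt S else 0) =
      (\<Sum>S \<in> {S \<in> {S. S \<subseteq> X \<and> Q S}. T w \<subseteq> S}. wt S)"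
      using X by (intro sum.inter_filter[symmetric]) auto
    also have "\<dots> \<le> (\<Sum>S | T w \<subseteq> S \<and> S \<subseteq> X. wt S)"
      using X wt by (intro sum_mono2) auto
    also have "\<dots> = p ^ card (T w)"
      unfolding wt_def using X T[OF w] by (rule sum_superset_card)
    finally show "(\<Sum>S | S \<subseteq> X \<and> Q S. if T w \<subseteq> S then wt S else 0) \<le> p ^ card (T w)" .
  qed
  finally show ?thesis by (simp add: wt_def)
qed

section \<open>The deterministic graph and its minimum degree\<close>

lemma finite_all_pairs: "finite (all_pairs n)"
proof (rule finite_subset)
  show "all_pairs n \<subseteq> Pow {0..<n}" by (auto simp: all_pairs_def)
qed simp

definition hub_graph :: "nat \<Rightarrow> nat \<Rightarrow> nat set set" where
  "hub_graph z n = {e. \<exists>u v. u < n \<and> v < n \<and> u \<noteq> v \<and> e = {u, v} \<and> (u < z \<or> v < z \<or> even u \<noteq> even v)}"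

lemma is_graph_hub_graph: "is_graph n (hub_graph z n)"
  by (auto simp: is_graph_def hub_graph_def all_pairs_def)

lemma hub_graph_edge:
  "{u, v} \<in> hub_graph z n \<longleftrightarrow> u < n \<and> v < n \<and> u \<noteq> v \<and> (u < z \<or> v < z \<or> even u \<noteq> even v)"
  by (auto simp: hub_graph_def doubleton_eq_iff)

lemma card_parity_class: "k \<le> 2 * card {u\<in>{a..<a+k}. even u = b} + 1"
proof (induction k rule: induct_nat_012)
  case (ge2 k)
  define c where "c = (if even (a + k) = b then a + k else Suc (a + k))"
  have "{u\<in>{a..<a + Suc (Suc k)}. even u = b} = insert c {u\<in>{a..<a+k}. even u = b}"
    by (auto simp: c_def less_Suc_eq)
  moreover have "c \<notin> {u\<in>{a..<a+k}. even u = b}" by (auto simp: c_def)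
  ultimately show ?case using ge2.IH(1) by simp
qed auto

lemma degree_hub_graph:
  assumes "v < n" "z \<le> n"
  shows "n + z \<le> 2 * degree (hub_graph z n) v + 1 \<or> n \<le> degree (hub_graph z n) v + 1"
proof (cases "v < z")
  case True
  then have "{u. {u, v} \<in> hub_graph z n} = {0..<n} - {v}"
    using assms by (auto simp: hub_graph_edge)
  then show ?thesis using assms by (simp add: degree_def)
next
  case False
  let ?B = "{u\<in>{z..<z+(n-z)}. even u = odd v}"
  have "{u. {u, v} \<in> hub_graph z n} = {0..<z} \<union> ?B"
    using assms False by (auto simp: hub_graph_edge)
  then have "degree (hub_graph z n) v = z + card ?B"
    unfolding degree_def by (simp add: card_Un_disjoint disjoint_iff)
  then show ?thesis using card_parity_class[of "n-z" z "odd v"] assms by linarith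
qed

lemma min_degree_hub_graph:
  assumes L: "1 \<le> L" and n: "8 * L \<le> n"
  shows "(1 / 2 + 1 / (8 * real L)) * n \<le> min_degree n (hub_graph (n div (2 * L)) n)"
proof -
  define z where "z = n div (2 * L)"
  have "n < 2 * L * (z + 1)"
    using dividend_less_times_div[of "2 * L" n] L by (simp add: z_def algebra_simps)
  then have "real n < real (2 * L * (z + 1))" by linarith
  then have z: "real n / (2 * L) \<le> z + 1" using L by (simp add: field_simps)
  have nL: "1 \<le> real n / (8 * L)" using n L by (simp add: field_simps)
  have n8: "real n / (8 * L) \<le> real n / 8" using L by (intro divide_left_mono) auto
  have nn: "8 \<le> n" using n L by linarith
  have "min_degree n (hub_graph z n) \<in> degree (hub_graph z n) ` {0..<n}"
    unfolding min_degree_def using nn by (intro Min_in) auto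
  then obtain v where v: "v < n" "min_degree n (hub_graph z n) = degree (hub_graph z n) v" by auto
  have "z \<le> n" by (simp add: z_def)
  from degree_hub_graph[OF v(1) this]
  have "(1 / 2 + 1 / (8 * real L)) * n \<le> degree (hub_graph z n) v"
  proof
    assume "n + z \<le> 2 * degree (hub_graph z n) v + 1"
    then have "real n + real z \<le> 2 * degree (hub_graph z n) v + 1" by linarith
    \<comment> \<open>Half of n/(2L) is n/(4L). One n/(8L) of it absorbs the rounding losses, at
      most 1 in total; the other is the required surplus.\<close>
    moreover have "real n / (2 * L) = 4 * (real n / (8 * L))" by simp
    ultimately show ?thesis using z nL by (simp add: distrib_right)
  next
    assume "n \<le> degree (hub_graph z n) v + 1"
    then have "real n \<le> degree (hub_graph z n) v + 1" by linarith
    then show ?thesis using n8 nn by (simp add: distrib_right)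
  qed
  then show ?thesis using v(2) by (simp add: z_def)
qed

section \<open>Forced random edges on a block of the cycle\<close>

definition parity_edges :: "nat \<Rightarrow> nat \<Rightarrow> nat list \<Rightarrow> nat set set" where
  "parity_edges m N vs =
     (\<lambda>(t, j). {vs ! t, vs ! (t + j)}) ` (SIGMA t:{..<N}. {j\<in>{1..m}. even (vs ! (t + j)) = even (vs ! t)})"

text \<open>As j >= 1 and \<open>vs\<close> is distinct, an edge determines its left index
  \<open>t\<close> and the distance \<open>j\<close>, so no edge is counted twice.\<close>

lemma card_parity_edges:
  assumes "distinct vs" "length vs = N + m"
  shows "card (parity_edges m N vs) = (\<Sum>t<N. same_after m (\<lambda>i. even (vs ! i)) t)"
proof -
  have "inj_on (\<lambda>(t, j). {vs ! t, vs ! (t + j)})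
      (SIGMA t:{..<N}. {j\<in>{1..m}. even (vs ! (t + j)) = even (vs ! t)})"
    using assms by (intro inj_onI) (auto simp: doubleton_eq_iff nth_eq_iff_index_eq)
  then show ?thesis
    unfolding parity_edges_def by (simp add: card_image same_after_def)
qed

lemma parity_edges_subset:
  assumes "distinct vs" "length vs = N + m" "set vs \<subseteq> {0..<n}"
  shows "parity_edges m N vs \<subseteq> all_pairs n"
proof
  fix e assume "e \<in> parity_edges m N vs"
  then obtain t j where tj: "t < N" "1 \<le> j" "j \<le> m" "e = {vs ! t, vs ! (t + j)}"
    by (auto simp: parity_edges_def)
  then have "vs ! t \<in> set vs" "vs ! (t + j) \<in> set vs" "vs ! t \<noteq> vs ! (t + j)"
    using assms by (auto simp: nth_eq_iff_index_eq)
  moreover have "vs ! t < n" "vs ! (t + j) < n" using calculation assms(3) by auto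
  ultimately show "e \<in> all_pairs n" unfolding all_pairs_def tj(4) by blast
qed

text \<open>Pigeonhole: if each of the n div L disjoint blocks contained a vertex below
  \<open>z\<close>, these would be n div L distinct vertices among only \<open>z\<close>.\<close>

lemma block_avoiding:
  fixes \<sigma> :: "nat \<Rightarrow> nat"
  assumes \<sigma>: "inj_on \<sigma> {0..<n}" and L: "0 < L" and z: "z < n div L"
  obtains b where "b < n div L" "\<And>i. i < L \<Longrightarrow> z \<le> \<sigma> (b * L + i)"
proof (rule ccontr)
  assume no: "\<not> thesis"
  have "\<forall>b<n div L. \<exists>i<L. \<sigma> (b * L + i) < z"
  proof (intro allI impI, rule ccontr)
    fix b assume "b < n div L" "\<not> (\<exists>i<L. \<sigma> (b * L + i) < z)"
    then have thesis using that[of b] by (metis not_le)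
    with no show False ..
  qed
  then obtain h where h: "\<And>b. b < n div L \<Longrightarrow> h b < L \<and> \<sigma> (b * L + h b) < z" by metis
  have lt: "b * L + h b < n" if "b < n div L" for b
  proof -
    have "b * L + h b < Suc b * L" using h[OF that] by simp
    also have "\<dots> \<le> n div L * L" using that by (intro mult_le_mono1) simp
    also have "\<dots> \<le> n" by simp
    finally show ?thesis .
  qed
  have "inj_on (\<lambda>b. \<sigma> (b * L + h b)) {..<n div L}"
  proof (rule inj_onI)
    fix b c assume bc: "b \<in> {..<n div L}" "c \<in> {..<n div L}" "\<sigma> (b * L + h b) = \<sigma> (c * L + h c)"
    then have eq: "b * L + h b = c * L + h c"
      using lt \<sigma> by (auto dest: inj_onD)
    have "b = (b * L + h b) div L" using h[of b] bc by simp
    also have "\<dots> = c" unfolding eq using h[of c] bc by simp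
    finally show "b = c" .
  qed
  moreover have "(\<lambda>b. \<sigma> (b * L + h b)) ` {..<n div L} \<subseteq> {..<z}" using h by auto
  ultimately have "card {..<n div L} \<le> card {..<z}" by (intro card_inj_on_le) auto
  then show False using z by simp
qed

text \<open>On a block outside the hub, \<open>hub_graph\<close> only joins different parities, so
  \<open>S\<close> must supply all equal-parity pairs.\<close>

lemma ham_power_parity_edges:
  assumes ham: "contains_ham_power m n (hub_graph z n \<union> S)"
    and N: "0 < N" and z: "z < n div (N + m)"
  obtains vs where "distinct vs" "length vs = N + m" "set vs \<subseteq> {0..<n}" "parity_edges m N vs \<subseteq> S"
proof -
  define L where "L = N + m"
  obtain \<sigma> where \<sigma>: "bij_betw \<sigma> {0..<n} {0..<n}"
    "\<And>i j. i < n \<Longrightarrow> j \<in> {1..m} \<Longrightarrow> {\<sigma> i, \<sigma> ((i + j) mod n)} \<in> hub_graph z n \<union> S"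
    using ham by (auto simp: contains_ham_power_def)
  have inj: "inj_on \<sigma> {0..<n}" using \<sigma>(1) by (rule bij_betw_imp_inj_on)
  obtain b where b: "b < n div L" "\<And>i. i < L \<Longrightarrow> z \<le> \<sigma> (b * L + i)"
    using block_avoiding[OF inj, of L z] N z by (auto simp: L_def)
  have "Suc b * L \<le> n div L * L" using b(1) by (intro mult_le_mono1) simp
  also have "\<dots> \<le> n" by simp
  finally have bn: "b * L + L \<le> n" by simp
  define vs where "vs = map \<sigma> [b * L..<b * L + L]"
  have nth: "vs ! i = \<sigma> (b * L + i)" if "i < L" for i using that by (simp add: vs_def)
  show ?thesis
  proof (rule that)
    show "distinct vs"
      using inj bn by (auto simp: vs_def distinct_map intro: inj_on_subset)
    show "length vs = N + m" by (simp add: vs_def L_def)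
    show "set vs \<subseteq> {0..<n}"
      using bn bij_betw_imp_surj_on[OF \<sigma>(1)] by (auto simp: vs_def)
    show "parity_edges m N vs \<subseteq> S"
    proof
      fix e assume "e \<in> parity_edges m N vs"
      then obtain t j where tj: "t < N" "j \<in> {1..m}" "even (vs ! (t + j)) = even (vs ! t)"
        "e = {vs ! t, vs ! (t + j)}"
        by (auto simp: parity_edges_def)
      have lt: "t < L" "t + j < L" using tj by (auto simp: L_def)
      then have "{\<sigma> (b * L + t), \<sigma> ((b * L + t + j) mod n)} \<in> hub_graph z n \<union> S"
        using bn tj by (intro \<sigma>(2)) auto
      \<comment> \<open>The block does not wrap around the end of the cyclic order.\<close>
      moreover have "(b * L + t + j) mod n = b * L + (t + j)" using lt bn by simp
      ultimately have "{vs ! t, vs ! (t + j)} \<in> hub_graph z n \<union> S"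
        using lt by (simp add: nth)
      moreover have "z \<le> vs ! t" "z \<le> vs ! (t + j)" using lt b(2) by (auto simp: nth)
      ultimately show "e \<in> S" using tj(3,4) by (auto simp: hub_graph_edge)
    qed
  qed
qed

section \<open>Probability estimate and choice of constants\<close>

lemma prob_union_hub_graph_le:
  assumes m: "2 \<le> m" and N: "0 < N" and z: "z < n div (N + m)"
    and \<alpha>: "0 \<le> \<alpha>" and p: "0 \<le> p" "p \<le> real n powr - \<alpha>"
  shows "prob_union_ham_power m n (hub_graph z n) p
    \<le> real n powr (real (N + m) - \<alpha> * (f_fun m (ell_m m) * N - 3 * real (m * m)))"
proof -
  define L where "L = N + m"
  define f where "f = f_fun m (ell_m m)"
  have n: "1 \<le> real n" using z by (cases n) auto
  have p1: "p \<le> 1" using p n \<alpha> powr_mono[of "-\<alpha>" 0 "real n"] by simp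
  define W where "W = {vs. distinct vs \<and> length vs = L \<and> set vs \<subseteq> {0..<n}}"
  have Wsub: "W \<subseteq> {vs. set vs \<subseteq> {0..<n} \<and> length vs = L}" by (auto simp: W_def)
  have Wfin: "finite W" by (rule finite_subset[OF Wsub]) (simp add: finite_lists_length_eq)
  have Wcard: "card W \<le> n ^ L"
    using card_mono[OF _ Wsub] by (simp add: finite_lists_length_eq card_lists_length_eq)
  have "prob_union_ham_power m n (hub_graph z n) p \<le> (\<Sum>vs\<in>W. p ^ card (parity_edges m N vs))"
    unfolding prob_union_ham_power_def
  proof (rule union_bound_supersets[OF finite_all_pairs Wfin p(1) p1])
    fix vs assume "vs \<in> W"
    then show "parity_edges m N vs \<subseteq> all_pairs n"
      by (intro parity_edges_subset) (auto simp: W_def L_def)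
  next
    fix S assume "S \<subseteq> all_pairs n" "contains_ham_power m n (hub_graph z n \<union> S)"
    then show "\<exists>vs\<in>W. parity_edges m N vs \<subseteq> S"
      using ham_power_parity_edges[OF _ N z] by (auto simp: W_def L_def) metis
  qed
  \<comment> \<open>Each candidate list forces at least f N - 3m^2 random edges, and p <=
    n^(-\<alpha>).\<close>
  also have "\<dots> \<le> (\<Sum>vs\<in>W. real n powr (- \<alpha> * (f * N - 3 * real (m * m))))"
  proof (rule sum_mono)
    fix vs assume "vs \<in> W"
    then have "card (parity_edges m N vs) = (\<Sum>t<N. same_after m (\<lambda>i. even (vs ! i)) t)"
      by (intro card_parity_edges) (auto simp: W_def L_def)
    then have c: "f * N - 3 * real (m * m) \<le> card (parity_edges m N vs)"
      using sum_same_after_ge[OF m, of N "\<lambda>i. even (vs ! i)"] by (simp add: f_def)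
    have "p ^ card (parity_edges m N vs) \<le> (real n powr - \<alpha>) ^ card (parity_edges m N vs)"
      using p by (intro power_mono)
    also have "\<dots> = real n powr (- \<alpha> * card (parity_edges m N vs))"
      using n by (simp add: powr_powr flip: powr_realpow)
    also have "\<dots> \<le> real n powr (- \<alpha> * (f * N - 3 * real (m * m)))"
      using n \<alpha> c by (intro powr_mono) (auto intro: mult_left_mono)
    finally show "p ^ card (parity_edges m N vs) \<le> real n powr (- \<alpha> * (f * N - 3 * real (m * m)))" .
  qed
  also have "\<dots> = card W * real n powr (- \<alpha> * (f * N - 3 * real (m * m)))" by simp
  also have "\<dots> \<le> real n ^ L * real n powr (- \<alpha> * (f * N - 3 * real (m * m)))"
    using Wcard by (intro mult_right_mono) (auto simp flip: of_nat_power)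
  also have "\<dots> = real n powr (real L - \<alpha> * (f * N - 3 * real (m * m)))"
    using n by (simp add: powr_realpow[symmetric] powr_add[symmetric])
  finally show ?thesis by (simp add: L_def f_def)
qed

theorem theorem1p1:
  fixes m :: nat and \<mu> :: real
  assumes "m \<ge> 2" and "\<mu> > 0"
  shows "\<exists>\<epsilon>>0. \<exists>G :: nat \<Rightarrow> nat set set.
           (\<forall>n. is_graph n (G n)) \<and>
           (\<forall>\<^sub>F n in sequentially. real (min_degree n (G n)) \<ge> (1/2 + \<epsilon>) * real n) \<and>
           (\<forall>p :: nat \<Rightarrow> real.
              (\<forall>n. 0 \<le> p n \<and> p n \<le> real n powr (- 1 / f_fun m (ell_m m) - \<mu>)) \<longrightarrow>
              ((\<lambda>n. prob_union_ham_power m n (G n) (p n)) \<longlonglongrightarrow> 0))"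
proof -
  define f where "f = f_fun m (ell_m m)"
  have f: "0 < f" unfolding f_def using assms by (intro f_ell_pos)
  define \<alpha> where "\<alpha> = 1 / f + \<mu>"
  have \<alpha>: "0 < \<alpha>" using f assms by (simp add: \<alpha>_def add_pos_pos)
  \<comment> \<open>\<open>N\<close> is so large that the surplus \<mu> f N exceeds the boundary
    losses m + 3 \<alpha> m^2 by at least 1.\<close>
  define N where "N = Suc (nat \<lceil>(real m + 1 + \<alpha> * (3 * real (m * m))) / (\<mu> * f)\<rceil>)"
  have "(real m + 1 + \<alpha> * (3 * real (m * m))) / (\<mu> * f) \<le> real N"
    unfolding N_def by linarith
  then have "real m + 1 + \<alpha> * (3 * real (m * m)) \<le> \<mu> * f * N"
    using f assms by (simp add: field_simps)
  \<comment> \<open>The part 1/f of \<alpha> cancels the \<open>N\<close> in the exponent of the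
    number n^(N + m) of candidate lists; the part \<mu> is pure gain.\<close>
  moreover have "\<alpha> * (f * N) = N + \<mu> * f * N" using f by (simp add: \<alpha>_def field_simps)
  ultimately have expo: "real (N + m) - \<alpha> * (f * N - 3 * real (m * m)) \<le> -1"
    by (simp add: right_diff_distrib)
  define L where "L = N + m"
  \<comment> \<open>The hub has at most half as many vertices as there are blocks of length
    \<open>L\<close>, so some block avoids it; yet its size is linear in \<open>n\<close>, which
    raises the minimum degree.\<close>
  define G where "G n = hub_graph (n div (2 * L)) n" for n
  show ?thesis
  proof (intro exI[of _ "1 / (8 * real L)"] exI[of _ G] conjI allI impI)
    show "1 / (8 * real L) > 0" by (simp add: L_def N_def)
    show "is_graph n (G n)" for n by (simp add: G_def is_graph_hub_graph)
    show "\<forall>\<^sub>F n in sequentially. (1 / 2 + 1 / (8 * real L)) * real n \<le> real (min_degree n (G n))"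
      using eventually_ge_at_top[of "8 * L"]
      by eventually_elim (unfold G_def, rule min_degree_hub_graph, auto simp: L_def N_def)
    fix p :: "nat \<Rightarrow> real"
    assume p: "\<forall>n. 0 \<le> p n \<and> p n \<le> real n powr (- 1 / f_fun m (ell_m m) - \<mu>)"
    show "(\<lambda>n. prob_union_ham_power m n (G n) (p n)) \<longlonglongrightarrow> 0"
    proof (rule tendsto_sandwich)
      show "(\<lambda>n. 0) \<longlonglongrightarrow> (0::real)" by simp
      show "(\<lambda>n. real n powr -1) \<longlonglongrightarrow> 0"
        by (rule tendsto_neg_powr) (auto simp: filterlim_real_sequentially)
      have le: "p n \<le> real n powr - \<alpha>" for n using p by (simp add: \<alpha>_def f_def)
      show "\<forall>\<^sub>F n in sequentially. 0 \<le> prob_union_ham_power m n (G n) (p n)"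
        using eventually_ge_at_top[of 1]
      proof eventually_elim
        case (elim n)
        have "p n \<le> 1"
          using le[of n] \<alpha> elim powr_mono[of "-\<alpha>" 0 "real n"] by simp
        then show ?case using p by (auto simp: prob_union_ham_power_def intro!: sum_nonneg)
      qed
      show "\<forall>\<^sub>F n in sequentially. prob_union_ham_power m n (G n) (p n) \<le> real n powr -1"
        using eventually_ge_at_top[of "2 * L"]
      proof eventually_elim
        case (elim n)
        have L: "0 < L" by (simp add: L_def N_def)
        have "0 < n div (2 * L)" using elim L by (simp add: div_greater_zero_iff)
        moreover have "n div (2 * L) * 2 \<le> n div L"
          by (metis div_mult2_eq div_times_less_eq_dividend mult.commute)
        ultimately have z: "n div (2 * L) < n div (N + m)" unfolding L_def[symmetric] by linarith
        have "prob_union_ham_power m n (G n) (p n)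
          \<le> real n powr (real (N + m) - \<alpha> * (f * N - 3 * real (m * m)))"
          unfolding G_def f_def using assms \<alpha> z p le[of n]
          by (intro prob_union_hub_graph_le) (auto simp: N_def)
        also have "\<dots> \<le> real n powr -1"
          using expo elim L by (intro powr_mono) auto
        finally show ?case .
      qed
    qed
  qed
qed

end
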